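(* There exists $T>1$ such that for all $t\ge T$, $$\frac{\pi}{4e}\log t\le\int_{\mathbf{R}^2}\frac{(1+|\xi|^2)^{-t}\sin^2\left(t\sqrt{\log(1+|\xi|^2)}\right)}{\log(1+|\xi|^2)}\,d\xi\le6\pi\log t.$$ *)

theory Defs
  imports "HOL-Analysis.Analysis"
begin

end

theory Submission
  imports Defs
begin

text \<open>
  Substituting \<open>s = sqrt (ln (1 + |\<xi>|\<^sup>2))\<close> turns the integral into
  \<open>2 \<pi>\<close> times the integral of \<open>exp (- (t - 1) s\<^sup>2) sin\<^sup>2 (t s) / s\<close> over \<open>s \<ge> 0\<close>.
  The logarithm is produced on \<open>[1/t, 1/sqrt t]\<close>, where the exponential is at least \<open>1/e\<close> and
  \<open>sin\<^sup>2\<close> averages to \<open>1/2\<close>. From above, \<open>sin\<^sup>2 (t s)\<close> is bounded by \<open>t\<^sup>2 s\<^sup>2\<close> on \<open>[0, 1/t]\<close>,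
  which contributes \<open>1/2\<close>, and by \<open>1\<close> elsewhere; \<open>[1/t, 1]\<close> contributes
  \<open>ln t\<close> and the tail at most \<open>1\<close>.
\<close>

section \<open>Change of variables from the plane to the half-line\<close>

text \<open>The image measure is determined by the areas of the discs
  \<open>sqrt (ln (1 + |\<xi>|\<^sup>2)) \<le> a\<close>, that is, by \<open>\<pi> (exp (a\<^sup>2) - 1)\<close>.\<close>

lemma distr_sqrt_ln_norm:
  "distr (lborel :: (real^2) measure) borel (\<lambda>\<xi>. sqrt (ln (1 + (norm \<xi>)\<^sup>2)))
     = density lborel (\<lambda>s. ennreal (2 * pi * s * exp (s\<^sup>2) * indicator {0..} s))"
    (is "distr _ _ ?\<rho> = ?N")
proof -
  let ?M = "distr (lborel :: (real^2) measure) borel ?\<rho>"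
  have meas: "?\<rho> \<in> borel_measurable lborel"
    by measurable
  have M: "emeasure ?M {..a} = ennreal (if 0 \<le> a then pi * (exp (a\<^sup>2) - 1) else 0)" for a
  proof (cases "0 \<le> a")
    case True
    have "?\<rho> \<xi> \<le> a \<longleftrightarrow> norm \<xi> \<le> sqrt (exp (a\<^sup>2) - 1)" for \<xi> :: "real^2"
    proof -
      have "?\<rho> \<xi> \<le> a \<longleftrightarrow> ln (1 + (norm \<xi>)\<^sup>2) \<le> a\<^sup>2"
        using True by (simp add: real_sqrt_le_iff')
      also have "\<dots> \<longleftrightarrow> 1 + (norm \<xi>)\<^sup>2 \<le> exp (a\<^sup>2)"
        using exp_le_cancel_iff[of "ln (1 + (norm \<xi>)\<^sup>2)" "a\<^sup>2"] by (simp add: add_pos_nonneg)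
      also have "\<dots> \<longleftrightarrow> (norm \<xi>)\<^sup>2 \<le> exp (a\<^sup>2) - 1"
        by linarith
      also have "\<dots> \<longleftrightarrow> norm \<xi> \<le> sqrt (exp (a\<^sup>2) - 1)"
        using real_sqrt_le_iff[of "(norm \<xi>)\<^sup>2" "exp (a\<^sup>2) - 1"] by simp
      finally show ?thesis .
    qed
    hence "?\<rho> -` {..a} = cball (0 :: real^2) (sqrt (exp (a\<^sup>2) - 1))"
      by (auto simp: dist_norm)
    thus ?thesis
      using True meas by (simp add: emeasure_distr emeasure_cball unit_ball_vol_2)
  next
    case False
    have "\<not> ?\<rho> \<xi> \<le> a" for \<xi> :: "real^2"
    proof -
      have "0 \<le> ?\<rho> \<xi>"
        by simp
      with False show ?thesis
        by linarith
    qed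
    hence "?\<rho> -` {..a} = {}"
      by blast
    thus ?thesis
      using False meas by (simp add: emeasure_distr)
  qed
  \<comment> \<open>The density is the derivative in \<open>a\<close> of the disc area
    \<open>pi * (exp (a\<^sup>2) - 1)\<close>, so integrating it from 0 gives that area
    back.\<close>
  have N: "emeasure ?N {..a} = ennreal (if 0 \<le> a then pi * (exp (a\<^sup>2) - 1) else 0)" for a
  proof -
    have "emeasure ?N {..a}
        = (\<integral>\<^sup>+s. ennreal (2 * pi * s * exp (s\<^sup>2)) * indicator {0..a} s \<partial>lborel)"
      by (subst emeasure_density)
         (auto intro!: nn_integral_cong split: split_indicator)
    also have "\<dots> = ennreal (if 0 \<le> a then pi * (exp (a\<^sup>2) - 1) else 0)"
    proof (cases "0 \<le> a")
      case True
      hence "(\<integral>\<^sup>+s. ennreal (2 * pi * s * exp (s\<^sup>2)) * indicator {0..a} s \<partial>lborel)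
          = ennreal (pi * exp (a\<^sup>2) - pi * exp (0\<^sup>2))"
        by (intro nn_integral_FTC_Icc[where F = "\<lambda>s. pi * exp (s\<^sup>2)"])
           (auto intro!: derivative_eq_intros)
      with True show ?thesis
        by (simp add: algebra_simps)
    qed simp
    finally show ?thesis .
  qed
  show ?thesis
  proof (rule measure_eqI_generator_eq[where E = "range (\<lambda>a::real. {..a})" and \<Omega> = UNIV
        and A = "\<lambda>n. {..real n}"])
    show "Int_stable (range (\<lambda>a::real. {..a}))"
      by (auto simp: Int_stable_def Int_atMost)
    show "sets ?M = sigma_sets UNIV (range (\<lambda>a::real. {..a}))"
         "sets ?N = sigma_sets UNIV (range (\<lambda>a::real. {..a}))"
      by (simp_all add: borel_eq_atMost)
    show "(\<Union>n. {..real n}) = UNIV"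
      using real_arch_simple by auto
  qed (use M N in auto)
qed

text \<open>A non-integrable \<open>h\<close> gives 0 on both sides, so the identity can be applied
  first and integrability settled afterwards on the half-line.\<close>

lemma integral_sqrt_ln_norm:
  fixes h :: "real \<Rightarrow> real"
  assumes [measurable]: "h \<in> borel_measurable borel"
  shows "(\<integral>\<xi>. h (sqrt (ln (1 + (norm \<xi>)\<^sup>2))) \<partial>(lborel :: (real^2) measure))
     = (\<integral>s. 2 * pi * s * exp (s\<^sup>2) * indicator {0..} s * h s \<partial>lborel)"
proof -
  have "(\<integral>\<xi>. h (sqrt (ln (1 + (norm \<xi>)\<^sup>2))) \<partial>(lborel :: (real^2) measure))
      = integral\<^sup>L (distr (lborel :: (real^2) measure) borel (\<lambda>\<xi>. sqrt (ln (1 + (norm \<xi>)\<^sup>2)))) h"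
    by (rule integral_distr[symmetric]) measurable
  also have "\<dots> = (\<integral>s. (2 * pi * s * exp (s\<^sup>2) * indicator {0..} s) *\<^sub>R h s \<partial>lborel)"
    unfolding distr_sqrt_ln_norm
    by (rule integral_density) (auto simp: indicator_def)
  finally show ?thesis
    by simp
qed

text \<open>The exponent \<open>t - 1\<close> is the \<open>t\<close> of the power less the 1 from
  the density \<open>exp (s\<^sup>2)\<close>. The factor \<open>s\<close> of the density cancels one
  \<open>s\<close> of the denominator, and \<open>2 * pi\<close> stays outside.\<close>

definition radial_integrand :: "real \<Rightarrow> real \<Rightarrow> real" where
  "radial_integrand t s = indicator {0..} s * exp (- (t - 1) * s\<^sup>2) * (sin (t * s))\<^sup>2 / s"

lemma radial_integrand_measurable [measurable]:
  "radial_integrand t \<in> borel_measurable borel"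
  unfolding radial_integrand_def by measurable

lemma radial_integrand_nonneg: "0 \<le> radial_integrand t s"
  by (simp add: radial_integrand_def indicator_def)

lemma integral_eq_radial_integral:
  "(\<integral>\<xi>. (1 + (norm \<xi>)\<^sup>2) powr (- t) * (sin (t * sqrt (ln (1 + (norm \<xi>)\<^sup>2))))\<^sup>2
        / ln (1 + (norm \<xi>)\<^sup>2) \<partial>(lborel :: (real^2) measure))
     = 2 * pi * (\<integral>s. radial_integrand t s \<partial>lborel)"
proof -
  define h where "h s = exp (- t * s\<^sup>2) * (sin (t * s))\<^sup>2 / s\<^sup>2" for s
  have [measurable]: "h \<in> borel_measurable borel"
    unfolding h_def by measurable
  have "(1 + (norm \<xi>)\<^sup>2) powr (- t) * (sin (t * sqrt (ln (1 + (norm \<xi>)\<^sup>2))))\<^sup>2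
        / ln (1 + (norm \<xi>)\<^sup>2) = h (sqrt (ln (1 + (norm \<xi>)\<^sup>2)))" for \<xi> :: "real^2"
  proof -
    have "1 + (norm \<xi>)\<^sup>2 \<noteq> 0"
      by (metis add_pos_nonneg less_irrefl zero_le_power2 zero_less_one)
    thus ?thesis
      by (simp add: h_def powr_def)
  qed
  hence "(\<integral>\<xi>. (1 + (norm \<xi>)\<^sup>2) powr (- t) * (sin (t * sqrt (ln (1 + (norm \<xi>)\<^sup>2))))\<^sup>2
        / ln (1 + (norm \<xi>)\<^sup>2) \<partial>(lborel :: (real^2) measure))
      = (\<integral>s. 2 * pi * s * exp (s\<^sup>2) * indicator {0..} s * h s \<partial>lborel)"
    by (simp add: integral_sqrt_ln_norm)
  also have "(\<lambda>s. 2 * pi * s * exp (s\<^sup>2) * indicator {0..} s * h s)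
      = (\<lambda>s. 2 * pi * radial_integrand t s)"
  proof
    fix s
    have "exp (- (t - 1) * s\<^sup>2) = exp (s\<^sup>2) * exp (- t * s\<^sup>2)"
      by (simp add: exp_add[symmetric] algebra_simps)
    thus "2 * pi * s * exp (s\<^sup>2) * indicator {0..} s * h s = 2 * pi * radial_integrand t s"
      \<comment> \<open>At \<open>s = 0\<close> both sides are 0, the left by its factor
        \<open>s\<close> and the right by division by zero.\<close>
      by (cases "s = 0") (simp_all add: h_def radial_integrand_def power2_eq_square)
  qed
  finally show ?thesis
    by simp
qed

section \<open>Upper bound and integrability\<close>

definition radial_majorant :: "real \<Rightarrow> real \<Rightarrow> real" where
  "radial_majorant t s = t\<^sup>2 * s * indicator {0..1/t} s + 1 / s * indicator {1/t..1} s
     + exp (- s) * indicator {0..} s"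

lemma has_bochner_integral_radial_majorant:
  assumes "1 \<le> t"
  shows "has_bochner_integral lborel (radial_majorant t) (1/2 + ln t + 1)"
proof -
  have "has_bochner_integral lborel (\<lambda>s. t\<^sup>2 * s * indicator {0..1/t} s)
      (t\<^sup>2 * (1/t)\<^sup>2 / 2 - t\<^sup>2 * 0\<^sup>2 / 2)"
    using assms by (intro has_bochner_integral_FTC_Icc_real) (auto intro!: derivative_eq_intros)
  moreover have "has_bochner_integral lborel (\<lambda>s. 1 / s * indicator {1/t..1} s) (ln 1 - ln (1/t))"
  proof (rule has_bochner_integral_FTC_Icc_real)
    fix s assume "1/t \<le> s"
    moreover have "0 < 1/t"
      using assms by simp
    ultimately have "0 < s"
      by linarith
    thus "(ln has_real_derivative 1/s) (at s)" "isCont (\<lambda>s. 1/s) s"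
      by (auto intro!: derivative_eq_intros)
  qed (use assms in simp)
  moreover have "has_bochner_integral lborel (\<lambda>s::real. exp (- s) * indicator {0..} s) 1"
  proof (rule has_bochner_integral_nn_integral)
    have "(\<integral>\<^sup>+s. ennreal (exp (- s)) * indicator {0..} s \<partial>lborel) = ennreal (0 - - exp (- 0))"
    proof (rule nn_integral_FTC_atLeast)
      show "((\<lambda>s::real. - exp (- s)) \<longlongrightarrow> 0) at_top"
        using tendsto_minus[OF filterlim_compose[OF exp_at_bot filterlim_uminus_at_bot_at_top]]
        by simp
    qed (auto intro!: derivative_eq_intros)
    thus "(\<integral>\<^sup>+s. ennreal (exp (- s) * indicator {0..} s) \<partial>lborel) = ennreal 1"
      by (simp add: ennreal_mult' ennreal_indicator)
  qed auto
  ultimately have "has_bochner_integral lborel (radial_majorant t)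
      ((t\<^sup>2 * (1/t)\<^sup>2 / 2 - t\<^sup>2 * 0\<^sup>2 / 2) + (ln 1 - ln (1/t)) + 1)"
    unfolding radial_majorant_def by (intro has_bochner_integral_add)
  thus ?thesis
    using assms by (simp add: power_divide ln_div)
qed

text \<open>Each range of \<open>s\<close> is controlled by one summand, and the other two are
  dropped as nonnegative. Hence the pieces may overlap, and \<open>exp (- s)\<close> may live on the
  whole half-line, where its integral is exactly 1.\<close>

lemma radial_integrand_le_majorant:
  assumes "2 \<le> t"
  shows "radial_integrand t s \<le> radial_majorant t s"
proof -
  have majorant_nonneg: "0 \<le> t\<^sup>2 * s * indicator {0..1/t} s" "0 \<le> 1 / s * indicator {1/t..1} s"
      "0 \<le> exp (- s) * indicator {0..} s"
    using assms by (auto simp: indicator_def intro: order_trans[of 0 "1/t"])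
  consider "s \<le> 0" | "0 < s" "s \<le> 1/t" | "1/t \<le> s" "s \<le> 1" "0 < s" | "1 \<le> s"
    by linarith
  thus ?thesis
  proof cases
    case 1
    hence "radial_integrand t s = 0"
      by (auto simp: radial_integrand_def indicator_def)
    thus ?thesis
      using majorant_nonneg unfolding radial_majorant_def by linarith
  next
    case 2
    have "(sin (t * s))\<^sup>2 \<le> (t * s)\<^sup>2"
      using abs_sin_x_le_abs_x[of "t * s"] by (simp add: abs_le_square_iff)
    moreover have "exp (- (t - 1) * s\<^sup>2) \<le> 1"
      using assms by (simp add: mult_nonpos_nonneg)
    ultimately have "exp (- (t - 1) * s\<^sup>2) * (sin (t * s))\<^sup>2 \<le> 1 * (t * s)\<^sup>2"
      by (intro mult_mono) auto
    hence "radial_integrand t s \<le> (t * s)\<^sup>2 / s"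
      using 2 by (auto simp: radial_integrand_def intro!: divide_right_mono)
    also have "\<dots> = t\<^sup>2 * s * indicator {0..1/t} s"
      using 2 by (simp add: power2_eq_square)
    finally show ?thesis
      using majorant_nonneg unfolding radial_majorant_def by linarith
  next
    case 3
    have "exp (- (t - 1) * s\<^sup>2) \<le> 1"
      using assms by (simp add: mult_nonpos_nonneg)
    hence "exp (- (t - 1) * s\<^sup>2) * (sin (t * s))\<^sup>2 \<le> 1 * 1"
      by (intro mult_mono) (auto simp: abs_square_le_1)
    hence "radial_integrand t s \<le> 1 / s * indicator {1/t..1} s"
      using 3 by (auto simp: radial_integrand_def intro!: divide_right_mono)
    thus ?thesis
      using majorant_nonneg unfolding radial_majorant_def by linarith
  next
    case 4
    \<comment> \<open>Here \<open>2 \<le> t\<close> gives \<open>1 \<le> t - 1\<close>, and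
      \<open>1 \<le> s\<close> gives \<open>s \<le> s\<^sup>2\<close>.\<close>
    have "1 * s \<le> (t - 1) * s\<^sup>2"
      using assms 4 by (intro mult_mono) (auto simp: power2_eq_square)
    hence "exp (- (t - 1) * s\<^sup>2) \<le> exp (- s)"
      by (simp add: algebra_simps)
    hence "exp (- (t - 1) * s\<^sup>2) * (sin (t * s))\<^sup>2 \<le> exp (- s) * 1"
      by (intro mult_mono) (auto simp: abs_square_le_1)
    \<comment> \<open>The extra factor \<open>s\<close> absorbs the division by \<open>s\<close> in
      the integrand.\<close>
    also have "\<dots> \<le> exp (- s) * s"
      using 4 by simp
    finally have "radial_integrand t s \<le> exp (- s) * indicator {0..} s"
      using 4 by (simp add: radial_integrand_def divide_le_eq)
    thus ?thesis
      using majorant_nonneg unfolding radial_majorant_def by linarith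
  qed
qed

lemma integrable_radial_integrand:
  assumes "2 \<le> t"
  shows "integrable lborel (radial_integrand t)"
proof (rule Bochner_Integration.integrable_bound)
  show "integrable lborel (radial_majorant t)"
    using has_bochner_integral_radial_majorant[of t] assms
    by (auto simp: has_bochner_integral_iff)
  show "AE s in lborel. norm (radial_integrand t s) \<le> norm (radial_majorant t s)"
    using radial_integrand_le_majorant[OF assms] radial_integrand_nonneg[of t]
    by (intro AE_I2) (metis abs_of_nonneg order_trans real_norm_def)
qed simp

lemma integral_radial_integrand_le:
  assumes "2 \<le> t"
  shows "(\<integral>s. radial_integrand t s \<partial>lborel) \<le> ln t + 3/2"
proof -
  have "has_bochner_integral lborel (radial_majorant t) (1/2 + ln t + 1)"
    using assms by (intro has_bochner_integral_radial_majorant) simp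
  hence "integrable lborel (radial_majorant t)"
      "(\<integral>s. radial_majorant t s \<partial>lborel) = ln t + 3/2"
    by (auto simp: has_bochner_integral_iff)
  thus ?thesis
    using integral_mono[OF integrable_radial_integrand[OF assms] _ radial_integrand_le_majorant[OF assms]]
    by simp
qed

section \<open>Lower bound\<close>

text \<open>
  Integrating by parts once, \<open>sin\<^sup>2 (t s) / s = (1 - cos (2 t s)) / (2 s)\<close> equals the derivative of
  \<open>ln s / 2 - sin (2 t s) / (4 t s)\<close> minus \<open>sin (2 t s) / (4 t s\<^sup>2)\<close>. Replacing the last sine by \<open>1\<close>
  gives the minorant used here, with antiderivative \<open>F\<close>.
\<close>

lemma integral_radial_integrand_ge:
  assumes t: "2 \<le> t"
  shows "exp (- 1) * (ln t / 4 - 1/2) \<le> (\<integral>s. radial_integrand t s \<partial>lborel)"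
proof -
  define F where "F s = ln s / 2 - sin (2 * t * s) / (4 * t * s) + 1 / (4 * t * s)" for s
  define f where "f s = (sin (t * s))\<^sup>2 / s - (1 - sin (2 * t * s)) / (4 * t * s\<^sup>2)" for s
  define a where "a = 1 / t"
  define b where "b = 1 / sqrt t"
  have a_pos: "0 < a" and b_pos: "0 < b"
    using t by (simp_all add: a_def b_def)
  have "sqrt t \<le> t"
    using t by (intro real_le_lsqrt) (auto simp: power2_eq_square)
  hence ab: "a \<le> b"
    using t by (simp add: a_def b_def frac_le)
  have FTC: "has_bochner_integral lborel (\<lambda>s. f s * indicator {a..b} s) (F b - F a)"
  proof (rule has_bochner_integral_FTC_Icc_real[OF ab])
    fix s assume "a \<le> s" "s \<le> b"
    hence s: "0 < s"
      using a_pos by linarith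
    \<comment> \<open>Differentiating \<open>F\<close> produces a cosine; the double-angle formula
      matches it with the squared sine in \<open>f\<close>.\<close>
    have "cos (2 * t * s) = 1 - 2 * (sin (t * s))\<^sup>2"
      using cos_double_sin[of "t * s"] by (simp add: mult.assoc)
    hence f_eq: "f s = (1 - cos (2 * t * s)) / (2 * s) - (1 - sin (2 * t * s)) / (4 * t * s\<^sup>2)"
      by (simp add: f_def)
    show "(F has_real_derivative f s) (at s)"
      unfolding F_def f_eq using s t
      by (auto intro!: derivative_eq_intros)
         (simp add: field_simps power2_eq_square)
    show "isCont f s"
      unfolding f_def using s t by (auto intro!: continuous_intros)
  qed
  have le: "exp (- 1) * (f s * indicator {a..b} s) \<le> radial_integrand t s" for s
  proof (cases "s \<in> {a..b}")
    case True
    hence s: "0 < s"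
      using a_pos by auto
    have "s\<^sup>2 \<le> b\<^sup>2"
      using True s by (intro power_mono) auto
    hence "t * s\<^sup>2 \<le> 1"
      using t by (simp add: b_def power_divide field_simps)
    hence "(t - 1) * s\<^sup>2 \<le> 1"
      by (simp add: left_diff_distrib) (smt (verit) zero_le_power2)
    hence "exp (- 1) \<le> exp (- (t - 1) * s\<^sup>2)"
      by (simp add: algebra_simps)
    \<comment> \<open>Since \<open>f\<close> can be negative, the exponential is bounded below while
      multiplying the nonnegative \<open>(sin (t * s))\<^sup>2 / s\<close>; only the constant
      \<open>exp (- 1)\<close> then multiplies \<open>f\<close>.\<close>
    hence "exp (- 1) * ((sin (t * s))\<^sup>2 / s) \<le> exp (- (t - 1) * s\<^sup>2) * ((sin (t * s))\<^sup>2 / s)"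
      using s by (intro mult_right_mono) auto
    moreover have "f s \<le> (sin (t * s))\<^sup>2 / s"
      using t by (simp add: f_def)
    hence "exp (- 1) * f s \<le> exp (- 1) * ((sin (t * s))\<^sup>2 / s)"
      by (intro mult_left_mono) auto
    ultimately show ?thesis
      using True s by (simp add: radial_integrand_def)
  qed (simp add: radial_integrand_nonneg)
  \<comment> \<open>At \<open>a\<close> the phase \<open>2 * t * a\<close> is 2, and the crude bound
    \<open>sin 2 \<ge> -1\<close> gives \<open>F a \<le> - ln t / 2 + 1/2\<close>. At
    \<open>b\<close> the non-logarithmic terms add up to something nonnegative, so
    \<open>F b \<ge> - ln t / 4\<close>.\<close>
  have "ln t / 4 - 1/2 \<le> F b - F a"
  proof -
    have "F a = - ln t / 2 - sin 2 / 4 + 1/4"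
      using t by (simp add: F_def a_def ln_div)
    moreover have "F b = - ln t / 4 + (1 - sin (2 * t * b)) / (4 * t * b)"
      using t b_pos by (simp add: F_def diff_divide_distrib) (simp add: b_def ln_div ln_sqrt)
    moreover have "0 \<le> (1 - sin (2 * t * b)) / (4 * t * b)"
      using t b_pos by simp
    moreover have "- 1 \<le> sin (2::real)"
      by simp
    ultimately show ?thesis
      by linarith
  qed
  hence "exp (- 1) * (ln t / 4 - 1/2) \<le> exp (- 1) * (F b - F a)"
    by (intro mult_left_mono) auto
  also have "\<dots> = (\<integral>s. exp (- 1) * (f s * indicator {a..b} s) \<partial>lborel)"
    using has_bochner_integral_integral_eq[OF FTC] by simp
  also have "\<dots> \<le> (\<integral>s. radial_integrand t s \<partial>lborel)"
    using FTC integrable_radial_integrand[OF t] le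
    by (intro integral_mono) (auto simp: has_bochner_integral_iff)
  finally show ?thesis .
qed

theorem proposition6p2:
  "\<exists>T::real. T > 1 \<and> (\<forall>t\<ge>T.
     pi / (4 * exp 1) * ln t
       \<le> (\<integral>\<xi>. (1 + (norm \<xi>)\<^sup>2) powr (- t) * (sin (t * sqrt (ln (1 + (norm \<xi>)\<^sup>2))))\<^sup>2
               / ln (1 + (norm \<xi>)\<^sup>2) \<partial>(lborel :: (real^2) measure))
   \<and> (\<integral>\<xi>. (1 + (norm \<xi>)\<^sup>2) powr (- t) * (sin (t * sqrt (ln (1 + (norm \<xi>)\<^sup>2))))\<^sup>2
               / ln (1 + (norm \<xi>)\<^sup>2) \<partial>(lborel :: (real^2) measure))
       \<le> 6 * pi * ln t)"
\<comment> \<open>The threshold comes from the lower bound: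
  \<open>ln t / 4 - 1/2 \<ge> ln t / 8\<close> holds exactly when \<open>ln t \<ge> 4\<close>, and 2
  pi / (8 e) is the required constant. The upper bound only asks for
  \<open>ln t + 3/2 \<le> 3 * ln t\<close>.\<close>
proof (intro exI[of _ "exp 4"] conjI allI impI)
  fix t :: real
  assume "exp 4 \<le> t"
  hence ln_t: "4 \<le> ln t"
    by (subst ln_ge_iff) (auto intro: less_le_trans[OF exp_gt_zero])
  have t: "2 \<le> t"
    using \<open>exp 4 \<le> t\<close> exp_ge_add_one_self[of 4] by linarith
  show "pi / (4 * exp 1) * ln t
       \<le> (\<integral>\<xi>. (1 + (norm \<xi>)\<^sup>2) powr (- t) * (sin (t * sqrt (ln (1 + (norm \<xi>)\<^sup>2))))\<^sup>2
               / ln (1 + (norm \<xi>)\<^sup>2) \<partial>(lborel :: (real^2) measure))"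
  proof -
    have "pi / (4 * exp 1) * ln t = 2 * pi * (exp (- 1) * (ln t / 8))"
      by (simp add: exp_minus field_simps)
    also have "\<dots> \<le> 2 * pi * (exp (- 1) * (ln t / 4 - 1/2))"
      using ln_t by (intro mult_left_mono) auto
    also have "\<dots> \<le> 2 * pi * (\<integral>s. radial_integrand t s \<partial>lborel)"
      using integral_radial_integrand_ge[OF t] by (intro mult_left_mono) auto
    finally show ?thesis
      unfolding integral_eq_radial_integral .
  qed
  show "(\<integral>\<xi>. (1 + (norm \<xi>)\<^sup>2) powr (- t) * (sin (t * sqrt (ln (1 + (norm \<xi>)\<^sup>2))))\<^sup>2
               / ln (1 + (norm \<xi>)\<^sup>2) \<partial>(lborel :: (real^2) measure))
       \<le> 6 * pi * ln t"
  proof -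
    have "2 * pi * (\<integral>s. radial_integrand t s \<partial>lborel) \<le> 2 * pi * (3 * ln t)"
      using integral_radial_integrand_le[OF t] ln_t by (intro mult_left_mono) auto
    thus ?thesis
      unfolding integral_eq_radial_integral by simp
  qed
qed simp

end
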